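(* Let $\overline{\overline{G}}(n,x)=\prod_{b=2}^{\lfloor x\rfloor}b^{\overline{\nu}(n,b)}$. Then for all integers $n\ge 2$ and real $\alpha\in\left[\frac{1}{\sqrt n},1\right]$, $$\log\overline{\overline{G}}(n,\alpha n)=f(\alpha)\,n^2\log n+g(\alpha)\,n^2+O\left(n^{3/2}\log n\right),$$ in which: (a) $f$ is the function with $f(0)=0$ and defined for all $\alpha>0$ by $$f(\alpha)=\frac12+\frac12\alpha^2\left\lfloor\frac1\alpha\right\rfloor^2+\frac12\alpha^2\left\lfloor\frac1\alpha\right\rfloor-\alpha\left\lfloor\frac1\alpha\right\rfloor;$$ (b) $g$ is the function with $g(0)=0$ and defined for all $\alpha>0$ by $$g(\alpha)=\left(\frac12\gamma-\frac34\right)-\frac12\left(H_{\lfloor\frac1\alpha\rfloor}-\log\frac1\alpha\right)+\left(\log\frac1\alpha\right)\left(-\frac12-\frac12\alpha^2\left\lfloor\frac1\alpha\right\rfloor\left\lfloor\frac1\alpha+1\right\rfloor+\alpha\left\lfloor\frac1\alpha\right\rfloor\right)-\frac14\alpha^2\left\lfloor\frac1\alpha\right\rfloor\left\lfloor\frac1\alpha+1\right\rfloor+\alpha\left\lfloor\frac1\alpha\right\rfloor.$$ Moreover, for all integers $n\ge 2$ and real $\alpha\in\left[\frac1n,\frac1{\sqrt n}\right]$, $$\log\overline{\overline{G}}(n,\alpha n)=O\left(n^{3/2}\log n\right).$$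
   Context: For integers $b\ge 2$ and $n\ge 1$, $d_b(n)$ denotes the sum of the base-$b$ digits of $n$, and $S_b(n):=\sum_{j=1}^{n-1}d_b(j)$. Define $$\overline{\nu}(n,b):=\frac{2}{b-1}S_b(n)-\frac{n-1}{b-1}d_b(n).$$ An empty product equals $1$. $\gamma$ is Euler's constant and $H_m=\sum_{k=1}^m\frac1k$ is the $m$-th harmonic number. The constants implied by the $O$-notation are absolute (independent of $n$ and $\alpha$). *)

theory Defs
  imports "HOL-Analysis.Analysis"
begin

text \<open>
  The sum of the base-\<open>b\<close> digits of \<open>n\<close>, for \<open>b \<ge> 2\<close>: position \<open>i\<close> carries the digit
  \<open>(n div b ^ i) mod b\<close>, and the positions occupied by \<open>n\<close> are those with \<open>b ^ i \<le> n\<close>.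
\<close>
definition digit_sum :: "nat \<Rightarrow> nat \<Rightarrow> nat" where
  "digit_sum b n = (\<Sum>i | b ^ i \<le> n. (n div b ^ i) mod b)"

definition digit_sum_total :: "nat \<Rightarrow> nat \<Rightarrow> nat" where
  "digit_sum_total b n = (\<Sum>j = 1..<n. digit_sum b j)"

definition nu_bar :: "nat \<Rightarrow> nat \<Rightarrow> real" where
  "nu_bar n b = 2 / (real b - 1) * real (digit_sum_total b n)
              - (real n - 1) / (real b - 1) * real (digit_sum b n)"

definition G_bar :: "nat \<Rightarrow> real \<Rightarrow> real" where
  "G_bar n x = (\<Prod>b = 2..nat \<lfloor>x\<rfloor>. real b powr nu_bar n b)"

definition f_scale :: "real \<Rightarrow> real" where
  "f_scale \<alpha> = (if \<alpha> > 0 then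
     1 / 2 + 1 / 2 * \<alpha>\<^sup>2 * (of_int \<lfloor>1 / \<alpha>\<rfloor>)\<^sup>2 + 1 / 2 * \<alpha>\<^sup>2 * of_int \<lfloor>1 / \<alpha>\<rfloor>
       - \<alpha> * of_int \<lfloor>1 / \<alpha>\<rfloor>
   else 0)"

definition g_scale :: "real \<Rightarrow> real" where
  "g_scale \<alpha> = (if \<alpha> > 0 then
     (1 / 2 * euler_mascheroni - 3 / 4)
       - 1 / 2 * (harm (nat \<lfloor>1 / \<alpha>\<rfloor>) - ln (1 / \<alpha>))
       + ln (1 / \<alpha>) *
           (- 1 / 2 - 1 / 2 * \<alpha>\<^sup>2 * of_int \<lfloor>1 / \<alpha>\<rfloor> * of_int \<lfloor>1 / \<alpha> + 1\<rfloor>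
             + \<alpha> * of_int \<lfloor>1 / \<alpha>\<rfloor>)
       - 1 / 4 * \<alpha>\<^sup>2 * of_int \<lfloor>1 / \<alpha>\<rfloor> * of_int \<lfloor>1 / \<alpha> + 1\<rfloor>
       + \<alpha> * of_int \<lfloor>1 / \<alpha>\<rfloor>
   else 0)"

end

theory Submission
  imports Defs "HOL-Library.Discrete_Functions"
begin

text \<open>
  Each base \<open>b \<le> n\<close> contributes \<open>O(n log n)\<close>, so the bases up to \<open>B = \<lfloor>\<surd>n\<rfloor>\<close> are negligible. For
  \<open>b > \<surd>n\<close> there are at most two digits, and with \<open>k = \<lfloor>n / b\<rfloor>\<close> the exponent is
  \<open>k (b (k + 1) - n) - k\<close>, where the final \<open>- k\<close> is again negligible. Writing
  \<open>k (b (k + 1) - n)\<close> as the sum of \<open>2 j b - n\<close> over \<open>1 \<le> j \<le> k\<close> and exchanging summations leaves,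
  for each \<open>j \<le> B\<close>, the sum of \<open>(2 j b - n) log b\<close> over \<open>B < b \<le> min (\<alpha> n) (n / j)\<close>. Its summand
  is a difference of two increasing functions bounded by \<open>2 n log n\<close>, so the sum agrees with the
  integral up to \<open>O(n log n)\<close>. The upper endpoints produce
  \<open>f(\<alpha>) n\<^sup>2 log n + g(\<alpha>) n\<^sup>2\<close> up to a quantity independent of \<open>\<alpha>\<close>, which the lower
  endpoint \<open>B\<close> cancels because \<open>H\<^sub>B - log B = \<gamma> + O(1 / B)\<close> and \<open>B\<^sup>2 = n + O(\<surd>n)\<close>.
\<close>

section \<open>Digit sums and the size of the exponent \<open>nu_bar\<close>\<close>

lemma digit_sum_two_digits:
  assumes "2 \<le> b" "n < b^2"
  shows "digit_sum b n = n div b + n mod b"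
proof -
  have "{i. b ^ i \<le> n} \<subseteq> {0, 1}"
  proof
    fix i assume "i \<in> {i. b ^ i \<le> n}"
    then have "b ^ i < b ^ 2" using assms(2) by simp
    then show "i \<in> {0, 1}" using assms(1) by (auto dest: power_less_imp_less_exp[rotated])
  qed
  \<comment> \<open>Position 1 is absent from the index set when \<open>n < b\<close>, but its digit
    is then zero, so passing to \<open>{0, 1}\<close> changes nothing.\<close>
  then have "digit_sum b n = (\<Sum>i\<in>{0, 1}. (n div b ^ i) mod b)"
    unfolding digit_sum_def by (intro sum.mono_neutral_left) auto
  also have "\<dots> = n mod b + (n div b) mod b" by simp
  also have "(n div b) mod b = n div b"
    using assms by (simp add: div_less_iff_less_mult power2_eq_square)
  finally show ?thesis by simp
qed

text \<open>The right-hand side is linear in \<open>n\<close> while the quotient stays constant, and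
  the formulas for two consecutive quotients agree at multiples of \<open>b\<close>; hence the case
  split in the induction. Doubling and working in \<open>int\<close> avoid halves and truncated
  subtraction.\<close>

lemma sum_div_const:
  assumes "0 < b"
  shows "2 * (\<Sum>j<n. int (j div b)) = 2 * int n * int (n div b) - int b * int (n div b) * (int (n div b) + 1)"
proof (induction n)
  case (Suc n)
  show ?case
  proof (cases "Suc n mod b = 0")
    case True
    then obtain q where q: "Suc n = b * q" by auto
    then have "q > 0" by (cases q) auto
    have "int n = int b * int q - 1" using q by (metis add_diff_cancel_left' of_nat_Suc of_nat_mult)
    moreover have "n div b = q - 1" using True q assms div_Suc[of n b] by simp
    moreover have "Suc n div b = q" using q assms by simp
    moreover have "int (q - 1) = int q - 1" using \<open>q > 0\<close> by (simp add: of_nat_diff)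
    moreover have "int (Suc n) = int b * int q" using q by (metis of_nat_mult)
    moreover have "2 * (\<Sum>j<Suc n. int (j div b)) = 2 * (\<Sum>j<n. int (j div b)) + 2 * int (n div b)" by simp
    ultimately show ?thesis unfolding Suc by (simp only:) (simp add: algebra_simps)
  next
    case False
    then show ?thesis using Suc by (simp add: div_Suc algebra_simps)
  qed
qed simp

lemma nu_bar_mult:
  assumes "2 \<le> b"
  shows "(real b - 1) * nu_bar n b
    = 2 * real (digit_sum_total b n) - (real n - 1) * real (digit_sum b n)"
proof -
  have "real b - 1 \<noteq> 0" using assms by simp
  then show ?thesis by (simp add: nu_bar_def right_diff_distrib)
qed

text \<open>With at most two digits, the digit sum of \<open>j\<close> is
  \<open>j - (b - 1) * (j div b)\<close>. In \<open>nu_bar\<close> the quadratic terms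
  \<open>n * (n - 1)\<close> then cancel, and everything left carries a factor \<open>b - 1\<close>,
  which cancels the denominator.\<close>

lemma nu_bar_two_digits:
  assumes "2 \<le> b" "n < b^2" "1 \<le> n"
  shows "nu_bar n b = real (n div b) * (real b * (real (n div b) + 1) - real n) - real (n div b)"
proof -
  define k where "k = real (n div b)"
  have dig: "real (digit_sum b j) = real j - (real b - 1) * real (j div b)" if "j \<le> n" for j
  proof -
    have "real j = real b * real (j div b) + real (j mod b)"
      by (metis mult_div_mod_eq of_nat_add of_nat_mult)
    then show ?thesis using digit_sum_two_digits[of b j] that assms by (simp add: algebra_simps)
  qed
  \<comment> \<open>The extra term at 0 vanishes; starting there matches
    \<open>sum_div_const\<close>.\<close>
  have S0: "digit_sum_total b n = (\<Sum>j<n. digit_sum b j)"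
    unfolding digit_sum_total_def using assms
    by (intro sum.mono_neutral_left) (auto simp: digit_sum_two_digits not_le)
  have "(\<Sum>j<n. 2 * real j) = real n * (real n - 1)"
    by (induction n) (auto simp: algebra_simps)
  moreover have "2 * (\<Sum>j<n. real (j div b)) = 2 * real n * k - real b * k * (k + 1)"
    using arg_cong[OF sum_div_const[of b n], of real_of_int] assms by (simp add: k_def)
  moreover have "2 * real (digit_sum_total b n)
      = (\<Sum>j<n. 2 * real j) - (real b - 1) * (2 * (\<Sum>j<n. real (j div b)))"
    by (simp add: S0 dig sum_subtractf sum_distrib_left[symmetric])
  ultimately have S: "2 * real (digit_sum_total b n)
      = real n * (real n - 1) - (real b - 1) * (2 * real n * k - real b * k * (k + 1))"
    by simp
  have "(real b - 1) * nu_bar n b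
      = 2 * real (digit_sum_total b n) - (real n - 1) * real (digit_sum b n)"
    using assms by (simp add: nu_bar_mult)
  also have "\<dots> = (real b - 1) * (k * (real b * (k + 1) - real n) - k)"
    unfolding S dig[OF order_refl] k_def[symmetric] by (simp add: algebra_simps)
  finally show ?thesis using assms by (simp add: k_def)
qed

text \<open>\<open>M\<close> is the position of the leading digit of \<open>n\<close>, so
  \<open>j\<close> has at most \<open>M + 1\<close> digits. The factor \<open>b - 1\<close> is kept
  to cancel the denominator of \<open>nu_bar\<close>.\<close>

lemma digit_sum_le:
  assumes "2 \<le> b" "b ^ M \<le> n" "\<And>i. b ^ i \<le> n \<Longrightarrow> i \<le> M" "j \<le> n"
  shows "real (digit_sum b j) \<le> (real b - 1) * (real M + 1)"
proof -
  have sub: "{i. b ^ i \<le> j} \<subseteq> {..M}" using assms by force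
  have "digit_sum b j \<le> (\<Sum>i\<in>{i. b ^ i \<le> j}. b - 1)"
    unfolding digit_sum_def using assms(1)
    by (intro sum_mono) (simp add: less_Suc_eq_le[symmetric])
  also have "\<dots> \<le> (\<Sum>i\<in>{..M}. b - 1)" using sub by (intro sum_mono2) auto
  finally have "digit_sum b j \<le> (b - 1) * (M + 1)" by (simp add: mult.commute)
  then have "real (digit_sum b j) \<le> real ((b - 1) * (M + 1))" using of_nat_le_iff by blast
  moreover have "real (b - 1) = real b - 1" using assms(1) by (simp add: of_nat_diff)
  ultimately show ?thesis by (simp only: of_nat_mult of_nat_add of_nat_1)
qed

text \<open>The digit count \<open>M + 1\<close> grows like \<open>ln n / ln b\<close>, so the
  weight \<open>ln b\<close> makes the bound uniform in \<open>b\<close>. The 6 is 2 + 1 from the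
  two terms of \<open>nu_bar\<close>, times 2 from
  \<open>(M + 1) * ln b <= 2 * ln n\<close>.\<close>

lemma abs_nu_bar_ln_le:
  assumes "2 \<le> b" "b \<le> n"
  shows "\<bar>nu_bar n b * ln (real b)\<bar> \<le> 6 * real n * ln (real n)"
proof -
  define M where "M = (GREATEST i. b ^ i \<le> n)"
  have bd: "i \<le> n" if "b ^ i \<le> n" for i
    using that assms(1) less_exp[of i] power_mono[of 2 b i] by linarith
  have "b ^ 0 \<le> n" using assms by simp
  then have M: "b ^ M \<le> n" unfolding M_def by (rule GreatestI_nat) (rule bd)
  have Mmax: "i \<le> M" if "b ^ i \<le> n" for i
    unfolding M_def using that by (rule Greatest_le_nat) (rule bd)
  define D where "D = (real b - 1) * (real M + 1)"
  have b1: "real b - 1 > 0" "ln (real b) \<ge> 0" and lnb: "ln (real b) \<le> ln (real n)" using assms by auto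
  have dle: "real (digit_sum b j) \<le> D" if "j \<le> n" for j
    unfolding D_def using digit_sum_le[OF assms(1) M Mmax that] .
  have "real (digit_sum_total b n) \<le> (\<Sum>j = 1..<n. D)"
    unfolding digit_sum_total_def of_nat_sum by (intro sum_mono dle) auto
  also have "\<dots> \<le> real n * D" using b1 by (simp add: D_def of_nat_diff mult_right_mono)
  finally have S: "real (digit_sum_total b n) \<le> real n * D" .
  have T: "(real n - 1) * real (digit_sum b n) \<le> real n * D"
    using dle[of n] assms by (intro mult_mono) auto
  have T0: "(real n - 1) * real (digit_sum b n) \<ge> 0" using assms by simp
  have eq: "(real b - 1) * nu_bar n b
      = 2 * real (digit_sum_total b n) - (real n - 1) * real (digit_sum b n)"
    using assms by (simp add: nu_bar_mult)
  have "(real b - 1) * \<bar>nu_bar n b\<bar> = \<bar>(real b - 1) * nu_bar n b\<bar>" using b1 by (simp add: abs_mult)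
  also have "\<dots> \<le> 3 * (real n * D)" unfolding eq using S T T0 by linarith
  also have "\<dots> = (real b - 1) * (3 * real n * (real M + 1))" by (simp add: D_def)
  finally have nu: "\<bar>nu_bar n b\<bar> \<le> 3 * real n * (real M + 1)" using b1 by simp
  have "real M * ln (real b) = ln (real (b ^ M))" using assms by (simp add: ln_realpow)
  also have "\<dots> \<le> ln (real n)" using M assms by (intro ln_mono) (auto simp: of_nat_le_iff[symmetric] simp del: of_nat_le_iff)
  finally have Mln: "(real M + 1) * ln (real b) \<le> 2 * ln (real n)" using lnb by (simp add: algebra_simps)
  have "\<bar>nu_bar n b * ln (real b)\<bar> \<le> 3 * real n * (real M + 1) * ln (real b)"
    using mult_right_mono[OF nu b1(2)] b1 by (simp add: abs_mult)
  also have "\<dots> \<le> 6 * real n * ln (real n)"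
    using mult_left_mono[OF Mln, of "3 * real n"] by (simp add: algebra_simps)
  finally show ?thesis .
qed

lemma ln_G_bar: "ln (G_bar n x) = (\<Sum>b = 2..nat \<lfloor>x\<rfloor>. nu_bar n b * ln (real b))"
  unfolding G_bar_def by (subst ln_prod) (auto simp: ln_powr)

section \<open>Comparing sums with integrals\<close>

text \<open>Mean value bounds on unit intervals telescope: up to \<open>p\<close>, the integer part
  of \<open>m\<close>, the sum exceeds the increment of \<open>U\<close> by an amount between 0 and
  \<open>u p\<close>. The remaining piece from \<open>p\<close> to \<open>m\<close> pulls the other
  way, by at most \<open>u m\<close>, so the two errors do not add up.\<close>

lemma abs_sum_diff_integral_le:
  fixes u U :: "real \<Rightarrow> real" and a :: nat and m :: real
  assumes am: "real a \<le> m"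
    and der: "\<And>t. real a \<le> t \<Longrightarrow> t \<le> m \<Longrightarrow> (U has_real_derivative u t) (at t)"
    and mono: "\<And>s t. real a \<le> s \<Longrightarrow> s \<le> t \<Longrightarrow> t \<le> m \<Longrightarrow> u s \<le> u t"
    and nonneg: "0 \<le> u a"
  shows "\<bar>(\<Sum>b\<in>{a<..nat \<lfloor>m\<rfloor>}. u (real b)) - (U m - U a)\<bar> \<le> u m"
proof -
  have mvt: "(t - s) * u s \<le> U t - U s \<and> U t - U s \<le> (t - s) * u t"
    if "real a \<le> s" "s \<le> t" "t \<le> m" for s t
  proof (cases "s < t")
    case True
    have "(U has_real_derivative u z) (at z)" if "s \<le> z" "z \<le> t" for z
      using der[of z] that \<open>real a \<le> s\<close> \<open>t \<le> m\<close> by linarith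
    from MVT2[OF True this] obtain z where z: "s < z" "z < t" "U t - U s = (t - s) * u z"
      by blast
    moreover have "u s \<le> u z" "u z \<le> u t" using mono[of s z] mono[of z t] z that by auto
    ultimately show ?thesis using True by simp
  qed (use that in auto)
  have sandwich: "U p - U a \<le> (\<Sum>b\<in>{a<..p}. u (real b)) \<and>
      (\<Sum>b\<in>{a<..p}. u (real b)) \<le> U p - U a + u p - u a" if "a \<le> p" "real p \<le> m" for p
    using that
  proof (induction p rule: dec_induct)
    case (step p)
    have "{a<..Suc p} = insert (Suc p) {a<..p}" using step by auto
    then have "(\<Sum>b\<in>{a<..Suc p}. u (real b)) = u (real p + 1) + (\<Sum>b\<in>{a<..p}. u (real b))"
      by (simp add: add.commute)
    moreover have "u p \<le> U (real p + 1) - U p" "U (real p + 1) - U p \<le> u (real p + 1)"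
      using mvt[of "real p" "real p + 1"] step.hyps step.prems by auto
    moreover have "real p \<le> m" using step.prems by simp
    ultimately show ?case using step.IH by (simp add: add.commute)
  qed simp
  define p where "p = nat \<lfloor>m\<rfloor>"
  have p: "a \<le> p" "real p \<le> m" "m - real p \<le> 1"
    using am by (auto simp: p_def le_nat_floor) linarith+
  have "U p - U a \<le> (\<Sum>b\<in>{a<..p}. u (real b))"
      "(\<Sum>b\<in>{a<..p}. u (real b)) \<le> U p - U a + u p"
    using sandwich[OF p(1,2)] nonneg by auto
  moreover have "0 \<le> U m - U p" "U m - U p \<le> u m"
  proof -
    have up: "0 \<le> u p" and um: "u p \<le> u m" using mono[of a p] mono[of p m] nonneg p by auto
    have "(m - p) * u m \<le> 1 * u m" using p up um by (intro mult_right_mono) auto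
    moreover have "0 \<le> (m - p) * u p" using p up by simp
    ultimately show "0 \<le> U m - U p" "U m - U p \<le> u m" using mvt[of p m] p by auto
  qed
  moreover have "u p \<le> u m" using mono p by auto
  ultimately show ?thesis unfolding p_def[symmetric] by linarith
qed

text \<open>An antiderivative of \<open>t \<mapsto> (2 j t - n) ln t\<close>.\<close>
definition block_prim :: "nat \<Rightarrow> nat \<Rightarrow> real \<Rightarrow> real" where
  "block_prim n j t = (real j * t\<^sup>2 - real n * t) * ln t - real j * t\<^sup>2 / 2 + real n * t"

text \<open>The summand need not be monotone, so its increasing parts \<open>u\<close> and
  \<open>v\<close> are treated separately. The hypothesis \<open>j * m <= n\<close> makes the error
  independent of \<open>j\<close>: \<open>u\<close> costs \<open>2 * n * ln n\<close> and
  \<open>v\<close> costs \<open>n * ln n\<close>.\<close>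

lemma block_sum_estimate:
  assumes "1 \<le> a" "real a \<le> m" "real j * m \<le> real n" "m \<le> real n"
  shows "\<bar>(\<Sum>b\<in>{a<..nat \<lfloor>m\<rfloor>}. (2 * real j * real b - real n) * ln (real b))
      - (block_prim n j m - block_prim n j (real a))\<bar> \<le> 3 * real n * ln (real n)"
proof -
  define u U v V where "u = (\<lambda>t. 2 * real j * t * ln t)" "U = (\<lambda>t. real j * t\<^sup>2 * ln t - real j * t\<^sup>2 / 2)"
    "v = (\<lambda>t. real n * ln t)" "V = (\<lambda>t. real n * t * ln t - real n * t)"
  note defs = this
  have a1: "1 \<le> real a" using assms(1) by simp
  have U: "\<bar>(\<Sum>b\<in>{a<..nat \<lfloor>m\<rfloor>}. u (real b)) - (U m - U a)\<bar> \<le> u m"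
  proof (rule abs_sum_diff_integral_le[OF assms(2)])
    show "(U has_real_derivative u t) (at t)" if "real a \<le> t" for t
      using that a1 unfolding defs
      by (auto intro!: derivative_eq_intros simp: power2_eq_square field_simps)
    show "u s \<le> u t" if "real a \<le> s" "s \<le> t" for s t
      using that a1 unfolding defs by (intro mult_mono) auto
  qed (use a1 in \<open>auto simp: defs\<close>)
  have V: "\<bar>(\<Sum>b\<in>{a<..nat \<lfloor>m\<rfloor>}. v (real b)) - (V m - V a)\<bar> \<le> v m"
  proof (rule abs_sum_diff_integral_le[OF assms(2)])
    show "(V has_real_derivative v t) (at t)" if "real a \<le> t" for t
      using that a1 unfolding defs
      by (auto intro!: derivative_eq_intros simp: power2_eq_square field_simps)
    show "v s \<le> v t" if "real a \<le> s" "s \<le> t" for s t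
      using that a1 unfolding defs by (intro mult_mono) auto
  qed (use a1 in \<open>auto simp: defs\<close>)
  have lnm: "0 \<le> ln m" "ln m \<le> ln (real n)" using assms a1 by auto
  have "u m = 2 * ((real j * m) * ln m)" by (simp add: defs)
  also have "\<dots> \<le> 2 * (real n * ln (real n))"
    using assms lnm by (intro mult_left_mono mult_mono) auto
  finally have um: "u m \<le> 2 * (real n * ln (real n))" .
  have vm: "v m \<le> real n * ln (real n)" using lnm by (auto simp: defs intro!: mult_left_mono)
  have "(\<Sum>b\<in>{a<..nat \<lfloor>m\<rfloor>}. (2 * real j * real b - real n) * ln (real b))
      = (\<Sum>b\<in>{a<..nat \<lfloor>m\<rfloor>}. u (real b)) - (\<Sum>b\<in>{a<..nat \<lfloor>m\<rfloor>}. v (real b))"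
    by (simp add: defs sum_subtractf[symmetric] algebra_simps)
  moreover have prim: "block_prim n j t = U t - V t" for t
    by (simp add: block_prim_def defs algebra_simps)
  ultimately show ?thesis using U V um vm unfolding prim by linarith
qed

section \<open>Exchanging the summations over \<open>b\<close> and \<open>j\<close>\<close>

lemma le_nat_floor_iff:
  fixes y :: real
  assumes "0 \<le> y"
  shows "b \<le> nat \<lfloor>y\<rfloor> \<longleftrightarrow> real b \<le> y"
  using assms by (simp add: le_nat_iff le_floor_iff)

lemma div_less_Suc:
  fixes n b B :: nat
  assumes "n < (Suc B)\<^sup>2" "B < b"
  shows "n div b < Suc B"
proof -
  have "Suc B * Suc B \<le> Suc B * b" using assms(2) by (intro mult_left_mono) auto
  then have "n < Suc B * b" using assms(1) unfolding power2_eq_square by linarith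
  then show ?thesis using assms(2) by (subst div_less_iff_less_mult) auto
qed

text \<open>Both sides run over pairs with \<open>j * b <= n\<close>. Read as
  \<open>j <= n div b\<close>, this condition gives the closed form for fixed \<open>b\<close>; read
  as \<open>b <= n / j\<close>, it truncates the range of \<open>b\<close>. As \<open>b > B\<close>,
  only \<open>j <= B\<close> can occur.\<close>

lemma sum_block_swap:
  fixes n B :: nat and x :: real
  assumes "n < (Suc B)\<^sup>2" "0 \<le> x"
  shows "(\<Sum>b\<in>{B<..nat \<lfloor>x\<rfloor>}. real (n div b) * (real b * (real (n div b) + 1) - real n) * ln (real b))
    = (\<Sum>j = 1..B. \<Sum>b\<in>{B<..nat \<lfloor>min x (real n / real j)\<rfloor>}. (2 * real j * real b - real n) * ln (real b))"
proof -
  have inner: "real (n div b) * (real b * (real (n div b) + 1) - real n) * ln (real b)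
      = (\<Sum>j = 1..B. if j * b \<le> n then (2 * real j * real b - real n) * ln (real b) else 0)"
    if b: "b \<in> {B<..nat \<lfloor>x\<rfloor>}" for b
  proof -
    have kB: "n div b < Suc B" using div_less_Suc[OF assms(1)] b by simp
    have iff: "j * b \<le> n \<longleftrightarrow> j \<le> n div b" for j
      using b by (subst less_eq_div_iff_mult_less_eq) auto
    have "{j \<in> {1..B}. j \<le> k} = {1..k}" if "k < Suc B" for k using that by auto
    from this[OF kB] have "{j \<in> {1..B}. j * b \<le> n} = {1..n div b}" unfolding iff .
    then have "(\<Sum>j = 1..B. if j * b \<le> n then (2 * real j * real b - real n) * ln (real b) else 0)
        = (\<Sum>j = 1..n div b. (2 * real j * real b - real n) * ln (real b))"
      by (simp add: sum.inter_filter[symmetric])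
    also have "\<dots> = (\<Sum>j = 1..n div b. 2 * real j * real b - real n) * ln (real b)"
      by (simp add: sum_distrib_right)
    also have "(\<Sum>j = 1..k. 2 * real j * real b - real n) = real k * (real b * (real k + 1) - real n)" for k
      by (induction k) (auto simp: algebra_simps)
    finally show ?thesis by simp
  qed
  have outer: "(\<Sum>b\<in>{B<..nat \<lfloor>x\<rfloor>}. if j * b \<le> n then (2 * real j * real b - real n) * ln (real b) else 0)
      = (\<Sum>b\<in>{B<..nat \<lfloor>min x (real n / real j)\<rfloor>}. (2 * real j * real b - real n) * ln (real b))"
    if j: "j \<in> {1..B}" for j
  proof -
    have iff: "j * b \<le> n \<longleftrightarrow> real b \<le> real n / real j" for b
      using j by (simp add: pos_le_divide_eq mult.commute flip: of_nat_mult)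
    have "{b \<in> {B<..nat \<lfloor>x\<rfloor>}. j * b \<le> n} = {B<..nat \<lfloor>min x (real n / real j)\<rfloor>}"
      unfolding iff using assms(2) by (auto simp: le_nat_floor_iff)
    then show ?thesis by (simp add: sum.inter_filter[symmetric])
  qed
  show ?thesis
    by (subst sum.cong[OF refl inner], assumption, subst sum.swap) (rule sum.cong[OF refl outer])
qed

section \<open>Upper endpoints and the scaling functions\<close>

lemma sum_block_prim:
  "(\<Sum>j = 1..k. block_prim n j t)
    = (real k * (real k + 1) / 2 * t\<^sup>2 - real k * real n * t) * ln t
      - real k * (real k + 1) / 4 * t\<^sup>2 + real k * real n * t"
  by (induction k) (simp_all add: block_prim_def algebra_simps add_divide_distrib)

text \<open>The factor \<open>j * t^2 - n * t\<close> of the logarithm vanishes at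
  \<open>t = n / j\<close>. Hence the truncated blocks yield harmonic numbers and no
  logarithms.\<close>

lemma block_prim_end:
  assumes "1 \<le> j"
  shows "block_prim n j (real n / real j) = (real n)\<^sup>2 / 2 * inverse (real j)"
  using assms by (simp add: block_prim_def power2_eq_square field_simps)

text \<open>The minimum equals \<open>x\<close> exactly for \<open>j <= k\<close>; beyond that
  \<open>block_prim_end\<close> applies.\<close>

lemma sum_block_prim_min:
  assumes "0 < x" "k = nat \<lfloor>real n / x\<rfloor>" "k \<le> B"
  shows "(\<Sum>j = 1..B. block_prim n j (min x (real n / real j)))
    = (\<Sum>j = 1..k. block_prim n j x) + (real n)\<^sup>2 / 2 * (harm B - harm k)"
proof -
  have iff: "j \<le> k \<longleftrightarrow> x \<le> real n / real j" if "1 \<le> j" for j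
    using assms(1) that unfolding assms(2)
    by (subst le_nat_floor_iff) (auto simp: field_simps)
  have split: "{1..B} = {1..k} \<union> {k<..B}" using assms(3) by auto
  have "(\<Sum>j = 1..B. block_prim n j (min x (real n / real j)))
      = (\<Sum>j = 1..k. block_prim n j (min x (real n / real j)))
        + (\<Sum>j\<in>{k<..B}. block_prim n j (min x (real n / real j)))"
    unfolding split by (rule sum.union_disjoint) auto
  moreover have "(\<Sum>j = 1..k. block_prim n j (min x (real n / real j))) = (\<Sum>j = 1..k. block_prim n j x)"
    using iff by (intro sum.cong) (auto simp: min_def)
  moreover have "(\<Sum>j\<in>{k<..B}. block_prim n j (min x (real n / real j)))
      = (\<Sum>j\<in>{k<..B}. (real n)\<^sup>2 / 2 * inverse (real j))"
  proof (rule sum.cong[OF refl])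
    fix j assume "j \<in> {k<..B}"
    then have "1 \<le> j" "\<not> x \<le> real n / real j" using iff[of j] by auto
    then show "block_prim n j (min x (real n / real j)) = (real n)\<^sup>2 / 2 * inverse (real j)"
      using block_prim_end[of j n] by (simp add: min_def)
  qed
  moreover have "(harm B :: real) = harm k + (\<Sum>j\<in>{k<..B}. inverse (real j))"
    unfolding harm_def split by (rule sum.union_disjoint) auto
  ultimately show ?thesis by (simp add: sum_distrib_left)
qed

text \<open>An exact identity: after splitting \<open>ln (\<alpha> * n)\<close> into
  \<open>ln \<alpha> + ln n\<close>, the coefficient of \<open>ln n\<close> is
  \<open>f_scale\<close> and the rest is \<open>g_scale\<close>. The last two terms do not depend on
  \<alpha>; \<open>boundary_estimate\<close> matches them with the lower endpoint.\<close>

lemma scale_identity: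
  assumes "0 < \<alpha>" "0 < n" "k = nat \<lfloor>1 / \<alpha>\<rfloor>"
  shows "f_scale \<alpha> * (real n)\<^sup>2 * ln (real n) + g_scale \<alpha> * (real n)\<^sup>2
    = (\<Sum>j = 1..k. block_prim n j (\<alpha> * real n)) - (real n)\<^sup>2 / 2 * harm k
      + (real n)\<^sup>2 / 2 * ln (real n) + (real n)\<^sup>2 * (euler_mascheroni / 2 - 3 / 4)"
proof -
  have "0 \<le> \<lfloor>1 / \<alpha>\<rfloor>" using assms(1) by simp
  then have k: "real_of_int \<lfloor>1 / \<alpha>\<rfloor> = real k" using assms(3) by simp
  have k1: "real_of_int \<lfloor>1 / \<alpha> + 1\<rfloor> = real k + 1" using k by simp
  have lns: "ln (1 / \<alpha>) = - ln \<alpha>" "ln (\<alpha> * real n) = ln \<alpha> + ln (real n)"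
    using assms by (simp_all add: ln_div ln_mult)
  show ?thesis
    unfolding sum_block_prim f_scale_def g_scale_def k k1 lns assms(3)[symmetric]
    using assms(1) by (simp add: power2_eq_square field_simps)
qed

section \<open>The lower endpoint\<close>

text \<open>The bounds in \<open>euler_mascheroni_bounds\<close> involve \<open>ln (Suc B)\<close>.
  Replacing it by \<open>ln B\<close> costs between 0 and \<open>1 / B\<close>, against a deviation
  of the opposite sign.\<close>

lemma harm_ln_euler_mascheroni:
  assumes "1 \<le> B"
  shows "\<bar>harm B - ln (real B) - euler_mascheroni\<bar> \<le> 1 / real B"
proof -
  have "1 + 1 / real B = real (Suc B) / real B" using assms by (simp add: field_simps)
  then have "ln (real (Suc B)) - ln (real B) = ln (1 + 1 / real B)"
    using assms by (simp add: ln_div del: of_nat_Suc)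
  moreover have "ln (1 + 1 / real B) \<le> 1 / real B" "0 \<le> ln (1 + 1 / real B)"
    using assms by (auto intro!: ln_add_one_self_le_self)
  moreover have "inverse (real (2 * B)) \<le> 1 / real B" "0 \<le> inverse (real (2 * (B + 1)))"
    using assms by (auto simp: field_simps)
  ultimately show ?thesis
    using euler_mascheroni_bounds[OF assms] unfolding atLeastAtMost_iff by linarith
qed

text \<open>This controls all that is independent of \<alpha>: the lower endpoint, the full harmonic
  number, and the two final terms of \<open>scale_identity\<close>.\<close>

lemma boundary_estimate:
  fixes n B :: nat
  assumes "2 \<le> n" "B\<^sup>2 \<le> n" "n < (Suc B)\<^sup>2" "1 \<le> B"
  shows "\<bar>(real n)\<^sup>2 / 2 * harm B - (real n)\<^sup>2 / 2 * ln (real n)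
      - (real n)\<^sup>2 * (euler_mascheroni / 2 - 3 / 4) - (\<Sum>j = 1..B. block_prim n j (real B))\<bar>
    \<le> 20 * (real n * sqrt (real n) * ln (real n))"
proof -
  define N b s L l where d: "N = real n" "b = real B" "s = sqrt (real n)" "L = ln (real n)" "l = ln (real B)"
  have lb: "ln b = l" by (simp add: d)
  have b1: "1 \<le> b" using assms d by simp
  have bN: "b\<^sup>2 \<le> N" using assms(2) d by (metis of_nat_le_iff of_nat_power)
  have "n \<le> B\<^sup>2 + 2 * B" using assms(3) by (simp add: power2_eq_square)
  then have "N \<le> real (B\<^sup>2 + 2 * B)" unfolding d(1) of_nat_le_iff .
  then have Nb: "N \<le> b\<^sup>2 + 2 * b" by (simp add: d)
  have N2: "2 \<le> N" and ss: "s * s = N" and s0: "0 < s" using assms d by auto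
  have bs: "b \<le> s" using bN d by (simp add: real_le_rsqrt)
  have "N \<le> (b + 1)\<^sup>2" using Nb by (simp add: power2_eq_square algebra_simps)
  then have "s \<le> b + 1" unfolding d(1,3) using b1 by (simp add: real_le_lsqrt d(1))
  then have sb: "s \<le> 2 * b" using b1 by simp
  \<comment> \<open>A positive lower bound for \<open>L\<close> lets errors of size
    \<open>N * s\<close> be absorbed into \<open>N * s * L\<close>.\<close>
  have "2 / 3 \<le> ln (2::real)" by (rule ln2_ge_two_thirds)
  also have "\<dots> \<le> L" using N2 d by simp
  finally have L: "2 / 3 \<le> L" .
  have l0: "0 \<le> l" using b1 d by simp
  have "2 * l = ln (b\<^sup>2)" using b1 d by (simp add: ln_realpow)
  then have Ll: "L - 2 * l = ln (N / b\<^sup>2)" using b1 N2 d by (simp add: ln_div)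
  have Ll0: "0 \<le> L - 2 * l" unfolding Ll using bN b1 by simp
  have "ln (N / b\<^sup>2) \<le> N / b\<^sup>2 - 1" using b1 N2 by (intro ln_le_minus_one) auto
  also have "\<dots> \<le> (b\<^sup>2 + 2 * b) / b\<^sup>2 - 1" using Nb by (simp add: divide_right_mono)
  also have "\<dots> = 2 / b" using b1 by (simp add: add_divide_distrib power2_eq_square)
  finally have Ll2: "L - 2 * l \<le> 2 / b" using Ll by simp
  have Nb2: "N\<^sup>2 / b \<le> 2 * (N * s)"
  proof -
    have "N\<^sup>2 = N * s * s" using ss by (simp add: power2_eq_square)
    also have "\<dots> \<le> N * s * (2 * b)" using sb s0 N2 by (intro mult_left_mono) auto
    finally show ?thesis using b1 by (simp add: field_simps)
  qed
  \<comment> \<open>\<open>P\<close> and \<open>Q\<close> are both of order \<open>1 / b\<close>,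
    and \<open>N^2 / b\<close> is at most \<open>2 * N * s\<close>.\<close>
  define P Q where "P = harm B - l - euler_mascheroni" "Q = L - 2 * l"
  note PQ = this
  have "\<bar>N\<^sup>2 / 2 * P\<bar> = N\<^sup>2 / 2 * \<bar>P\<bar>" by (simp add: abs_mult)
  also have "\<dots> \<le> N\<^sup>2 / 2 * (1 / b)"
    using harm_ln_euler_mascheroni[OF assms(4)] unfolding PQ d by (intro mult_left_mono) auto
  finally have e1: "\<bar>N\<^sup>2 / 2 * P\<bar> \<le> N * s" using Nb2 by simp
  have "N\<^sup>2 / 2 * Q \<le> N\<^sup>2 / 2 * (2 / b)" using Ll2 unfolding PQ by (intro mult_left_mono) auto
  also have "\<dots> = N\<^sup>2 / b" by simp
  finally have e2: "N\<^sup>2 / 2 * Q \<le> 2 * (N * s)" using Nb2 by linarith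
  have e2': "0 \<le> N\<^sup>2 / 2 * Q" using Ll0 unfolding PQ by (intro mult_nonneg_nonneg) auto
  have w: "0 \<le> N - b\<^sup>2" "N - b\<^sup>2 \<le> 2 * s" using bN Nb bs by auto
  have lL: "2 * l \<le> L" using Ll0 by simp
  have s1: "1 \<le> s" using bs b1 by simp
  have "(N - b\<^sup>2)\<^sup>2 \<le> (2 * s)\<^sup>2" using w by (intro power_mono) auto
  then have "(N - b\<^sup>2)\<^sup>2 / 2 * l \<le> 2 * N * l" using ss l0 by (intro mult_right_mono) (auto simp: power2_eq_square)
  also have "\<dots> \<le> N * L" using lL N2 by simp
  also have "\<dots> \<le> N * s * L" using s1 N2 L by simp
  finally have e3: "(N - b\<^sup>2)\<^sup>2 / 2 * l \<le> N * s * L" "0 \<le> (N - b\<^sup>2)\<^sup>2 / 2 * l" using l0 by auto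
  have b3: "b ^ 3 \<le> N * s" 
  proof -
    have "b ^ 3 = b\<^sup>2 * b" by (simp add: power2_eq_square power3_eq_cube)
    also have "\<dots> \<le> N * s" using bN bs b1 N2 by (intro mult_mono) auto
    finally show ?thesis .
  qed
  have "0 \<le> b ^ 3" using b1 by simp
  then have "b ^ 3 / 2 \<le> N * s" using b3 by linarith
  then have "b ^ 3 / 2 * l \<le> N * s * L" using lL l0 b1 N2 s0 by (intro mult_mono) auto
  then have e4: "b ^ 3 / 2 * l \<le> N * s * L" "0 \<le> b ^ 3 / 2 * l" using l0 b1 by auto
  have "(N - b\<^sup>2) * (3 * N - b\<^sup>2) \<le> 2 * s * (3 * N)" using w bN N2 s0 by (intro mult_mono) auto
  moreover have "0 \<le> (N - b\<^sup>2) * (3 * N - b\<^sup>2)" using w bN N2 by (intro mult_nonneg_nonneg) auto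
  moreover have "2 * s * (3 * N) = 6 * (N * s)" by simp
  ultimately have e5: "(N - b\<^sup>2) * (3 * N - b\<^sup>2) / 4 \<le> 3 / 2 * (N * s)" "0 \<le> (N - b\<^sup>2) * (3 * N - b\<^sup>2) / 4" by linarith+
  have b30: "0 \<le> b ^ 3" using b1 by simp
  have "N * s * (2 / 3) \<le> N * s * L" using L N2 s0 by (intro mult_left_mono) auto
  then have NsL: "N * s \<le> 3 / 2 * (N * s * L)" by simp
  \<comment> \<open>Substituting \<open>harm B = P + l + \<gamma>\<close> and
    \<open>L = Q + 2 * l\<close>, the terms in \<open>l\<close> complete a square and the log-free
    terms acquire a factor \<open>N - b^2\<close>, leaving only cubes of \<open>b\<close>. All are
    small as \<open>0 <= N - b^2 <= 2 * b\<close>.\<close>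
  have "N\<^sup>2 / 2 * harm B - N\<^sup>2 / 2 * L
      - N\<^sup>2 * (euler_mascheroni / 2 - 3 / 4) - (\<Sum>j = 1..B. block_prim n j b)
    = N\<^sup>2 / 2 * P - N\<^sup>2 / 2 * Q - (N - b\<^sup>2)\<^sup>2 / 2 * l - b ^ 3 / 2 * l
      + (N - b\<^sup>2) * (3 * N - b\<^sup>2) / 4 + b ^ 3 / 4"
    unfolding sum_block_prim d(1)[symmetric] d(2)[symmetric] lb PQ
    by (simp add: power2_eq_square power3_eq_cube field_simps)
  \<comment> \<open>The log-free parts total at most \<open>5 * N * s\<close> and the
    \<open>l\<close> parts at most \<open>2 * N * s * L\<close>, so 20 is generous.\<close>
  then show ?thesis unfolding d(3,4)[symmetric] unfolding d(1,2)[symmetric] using e1 e2 e2' e3 e4 e5 b30 b3 NsL by linarith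
qed

section \<open>Assembling the estimates\<close>

lemma powr_three_halves: "0 \<le> x \<Longrightarrow> x powr (3 / 2) = x * sqrt x" for x :: real
  using powr_add[of x 1 "1 / 2"] by (simp add: powr_half_sqrt)

text \<open>With \<open>s\<close> the square root of \<open>n\<close>, this disposes of the small
  bases for large \<alpha> and of all bases for small \<alpha>.\<close>

lemma abs_sum_nu_bar_ln_le:
  assumes "X \<le> n" "1 \<le> n" "real X \<le> s"
  shows "\<bar>\<Sum>b = 2..X. nu_bar n b * ln (real b)\<bar> \<le> 6 * (real n * s * ln (real n))"
proof -
  have "\<bar>\<Sum>b = 2..X. nu_bar n b * ln (real b)\<bar> \<le> (\<Sum>b = 2..X. 6 * real n * ln (real n))"
    using assms(1) by (intro order_trans[OF sum_abs] sum_mono abs_nu_bar_ln_le) auto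
  also have "\<dots> = real (X - 1) * (6 * real n * ln (real n))" by simp
  also have "\<dots> \<le> s * (6 * real n * ln (real n))"
    using assms by (intro mult_right_mono mult_nonneg_nonneg) auto
  finally show ?thesis by (simp add: mult_ac)
qed

text \<open>For \<open>b > B\<close> there are at most two digits, so the difference is the dropped
  \<open>- k\<close> of \<open>nu_bar_two_digits\<close>: at most \<open>B\<close> for each of at
  most \<open>n\<close> bases, weighted by \<open>ln b\<close>.\<close>

lemma large_base_estimate:
  fixes n B X :: nat
  assumes "1 \<le> n" "n < (Suc B)\<^sup>2" "1 \<le> B" "X \<le> n"
  shows "\<bar>(\<Sum>b\<in>{B<..X}. nu_bar n b * ln (real b))
      - (\<Sum>b\<in>{B<..X}. real (n div b) * (real b * (real (n div b) + 1) - real n) * ln (real b))\<bar>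
    \<le> real n * real B * ln (real n)"
proof -
  have diff: "\<bar>nu_bar n b * ln (real b)
      - real (n div b) * (real b * (real (n div b) + 1) - real n) * ln (real b)\<bar> \<le> real B * ln (real n)"
    if b: "b \<in> {B<..X}" for b
  proof -
    have b2: "2 \<le> b" using b assms(3) by simp
    have "(Suc B)\<^sup>2 \<le> b\<^sup>2" using b by (intro power_mono) auto
    then have nb: "n < b\<^sup>2" using assms(2) by linarith
    have kB: "real (n div b) \<le> real B" using div_less_Suc[OF assms(2), of b] b by simp
    have "\<bar>nu_bar n b * ln (real b)
        - real (n div b) * (real b * (real (n div b) + 1) - real n) * ln (real b)\<bar>
      = real (n div b) * ln (real b)"
      using b2 unfolding nu_bar_two_digits[OF b2 nb assms(1)] left_diff_distrib by simp
    also have "\<dots> \<le> real B * ln (real n)"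
      using kB b b2 assms by (intro mult_mono) auto
    finally show ?thesis .
  qed
  have "\<bar>(\<Sum>b\<in>{B<..X}. nu_bar n b * ln (real b))
      - (\<Sum>b\<in>{B<..X}. real (n div b) * (real b * (real (n div b) + 1) - real n) * ln (real b))\<bar>
    \<le> (\<Sum>b\<in>{B<..X}. real B * ln (real n))"
    unfolding sum_subtractf[symmetric] by (intro order_trans[OF sum_abs] sum_mono diff)
  also have "\<dots> = real (X - B) * (real B * ln (real n))" by simp
  also have "\<dots> \<le> real n * (real B * ln (real n))"
    using assms by (intro mult_right_mono mult_nonneg_nonneg) auto
  finally show ?thesis by (simp add: mult.assoc)
qed

text \<open>The constant is 6 (small bases) + 1 (dropped \<open>- k\<close>) + 3 (sums against
  integrals) + 20 (lower endpoint).\<close>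

lemma ln_G_bar_estimate:
  assumes n: "2 \<le> n" and a: "1 / sqrt (real n) \<le> \<alpha>" "\<alpha> \<le> 1"
  shows "\<bar>ln (G_bar n (\<alpha> * real n))
      - (f_scale \<alpha> * (real n)\<^sup>2 * ln (real n) + g_scale \<alpha> * (real n)\<^sup>2)\<bar>
    \<le> 30 * (real n * sqrt (real n) * ln (real n))"
proof -
  define B s x X E where d: "B = floor_sqrt n" "s = sqrt (real n)" "x = \<alpha> * real n"
    "X = nat \<lfloor>x\<rfloor>" "E = real n * s * ln (real n)"
  have B: "B\<^sup>2 \<le> n" "n < (Suc B)\<^sup>2" "1 \<le> B"
    unfolding d using Suc_floor_sqrt_power2_gt n by (auto simp: le_floor_sqrt_iff)
  have Bs: "real B \<le> s" unfolding d(2)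
    using B(1) by (intro real_le_rsqrt) (metis of_nat_le_iff of_nat_power)
  have s0: "0 < s" "s * s = real n" using n by (auto simp: d)
  have L0: "0 \<le> ln (real n)" using n by simp
  have a0: "0 < \<alpha>" using a s0 unfolding d(2) by (meson divide_pos_pos less_le_trans zero_less_one)
  \<comment> \<open>The lower bound on \<alpha> gives \<open>B <= X\<close>, so the bases can be
    split at \<open>B\<close>.\<close>
  have "1 / s * real n \<le> x" unfolding d(2,3) using a(1) by (intro mult_right_mono) auto
  then have sx: "s \<le> x" unfolding d(2) by (simp add: real_div_sqrt)
  have xn: "x \<le> real n" unfolding d(3) using mult_right_mono[OF a(2), of "real n"] by simp
  have x0: "0 < x" using sx s0 by simp
  have Xn: "X \<le> n" unfolding d(4) using xn by linarith
  have BX: "B \<le> X" unfolding d(4) using le_nat_floor_iff[of x B] Bs sx x0 by simp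
  have BE: "real n * real B * ln (real n) \<le> E"
    unfolding d(5) using Bs L0 by (intro mult_right_mono mult_left_mono) auto

  have small: "\<bar>\<Sum>b = 2..B. nu_bar n b * ln (real b)\<bar> \<le> 6 * E"
    unfolding d(5) using abs_sum_nu_bar_ln_le[of B n s] BX Xn n Bs by simp
  have large: "\<bar>(\<Sum>b\<in>{B<..X}. nu_bar n b * ln (real b))
      - (\<Sum>b\<in>{B<..X}. real (n div b) * (real b * (real (n div b) + 1) - real n) * ln (real b))\<bar> \<le> E"
    using large_base_estimate[of n B X] B Xn n BE by linarith

  define k where "k = nat \<lfloor>1 / \<alpha>\<rfloor>"
  have kx: "k = nat \<lfloor>real n / x\<rfloor>" unfolding k_def d(3) using n by simp
  \<comment> \<open>The same lower bound gives \<open>k^2 <= n\<close>, so the blocks ending at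
    \<open>x\<close> are among the \<open>j <= B\<close>.\<close>
  have "real k \<le> 1 / \<alpha>" using a0 unfolding k_def by simp
  also have "\<dots> \<le> s" using a(1) a0 s0 unfolding d(2) by (simp add: field_simps)
  finally have "real k ^ 2 \<le> s ^ 2" by (intro power_mono) auto
  then have "real (k\<^sup>2) \<le> real n" using s0 by (simp add: power2_eq_square)
  then have kB: "k \<le> B" unfolding d(1) le_floor_sqrt_iff of_nat_le_iff .

  define m where "m = (\<lambda>j. min x (real n / real j))"
  have blocks: "\<bar>(\<Sum>j = 1..B. \<Sum>b\<in>{B<..nat \<lfloor>m j\<rfloor>}. (2 * real j * real b - real n) * ln (real b))
      - (\<Sum>j = 1..B. block_prim n j (m j) - block_prim n j (real B))\<bar> \<le> 3 * E"
  proof -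
    have "\<bar>(\<Sum>b\<in>{B<..nat \<lfloor>m j\<rfloor>}. (2 * real j * real b - real n) * ln (real b))
        - (block_prim n j (m j) - block_prim n j (real B))\<bar> \<le> 3 * real n * ln (real n)"
      if j: "j \<in> {1..B}" for j
    proof (rule block_sum_estimate)
      \<comment> \<open>Since \<open>B * j <= n\<close>, no block ends below its start
        \<open>B\<close>.\<close>
      have "real B * real j \<le> s * s" using Bs j s0 by (intro mult_mono) auto
      then show "real B \<le> m j" using Bs sx j s0 unfolding m_def by (simp add: pos_le_divide_eq)
      have "real j * m j \<le> real j * (real n / real j)" unfolding m_def by (intro mult_left_mono) auto
      then show "real j * m j \<le> real n" using j by simp
    qed (use B xn in \<open>auto simp: m_def\<close>)
    then have "(\<Sum>j = 1..B. \<bar>(\<Sum>b\<in>{B<..nat \<lfloor>m j\<rfloor>}. (2 * real j * real b - real n) * ln (real b))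
        - (block_prim n j (m j) - block_prim n j (real B))\<bar>) \<le> (\<Sum>j = 1..B. 3 * real n * ln (real n))"
      by (rule sum_mono)
    also have "\<dots> = 3 * (real n * real B * ln (real n))" by simp
    also have "\<dots> \<le> 3 * E" using BE by simp
    finally show ?thesis unfolding sum_subtractf[symmetric] by (rule order_trans[OF sum_abs])
  qed

  have "{2..X} = {2..B} \<union> {B<..X}" using B BX by auto
  then have "ln (G_bar n x) = (\<Sum>b\<in>{2..B} \<union> {B<..X}. nu_bar n b * ln (real b))"
    unfolding ln_G_bar d(4) by simp
  also have "\<dots> = (\<Sum>b = 2..B. nu_bar n b * ln (real b)) + (\<Sum>b\<in>{B<..X}. nu_bar n b * ln (real b))"
    by (rule sum.union_disjoint) auto
  finally have G: "ln (G_bar n x) = \<dots>" .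
  have swap: "(\<Sum>b\<in>{B<..X}. real (n div b) * (real b * (real (n div b) + 1) - real n) * ln (real b))
      = (\<Sum>j = 1..B. \<Sum>b\<in>{B<..nat \<lfloor>m j\<rfloor>}. (2 * real j * real b - real n) * ln (real b))"
    unfolding d(4) m_def using sum_block_swap[OF B(2), of x] x0 by simp
  have main: "(\<Sum>j = 1..B. block_prim n j (m j) - block_prim n j (real B))
      = (\<Sum>j = 1..k. block_prim n j x) + (real n)\<^sup>2 / 2 * harm B - (real n)\<^sup>2 / 2 * harm k
        - (\<Sum>j = 1..B. block_prim n j (real B))"
    unfolding sum_subtractf m_def sum_block_prim_min[OF x0 kx kB] by (simp add: right_diff_distrib)
  have "f_scale \<alpha> * (real n)\<^sup>2 * ln (real n) + g_scale \<alpha> * (real n)\<^sup>2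
      = (\<Sum>j = 1..k. block_prim n j x) - (real n)\<^sup>2 / 2 * harm k
        + (real n)\<^sup>2 / 2 * ln (real n) + (real n)\<^sup>2 * (euler_mascheroni / 2 - 3 / 4)"
    unfolding d(3) using a0 n by (intro scale_identity) (auto simp: k_def)
  moreover have "\<bar>(real n)\<^sup>2 / 2 * harm B - (real n)\<^sup>2 / 2 * ln (real n)
      - (real n)\<^sup>2 * (euler_mascheroni / 2 - 3 / 4) - (\<Sum>j = 1..B. block_prim n j (real B))\<bar> \<le> 20 * E"
    unfolding d(5) d(2) by (rule boundary_estimate[OF n B])
  ultimately show ?thesis
    unfolding d(3)[symmetric] d(2)[symmetric] d(5)[symmetric] G
    using small large blocks unfolding swap main by linarith
qed

theorem theorem1p2:
  shows "(\<exists>C::real. \<forall>n::nat. \<forall>\<alpha>::real. n \<ge> 2 \<longrightarrow> 1 / sqrt (real n) \<le> \<alpha> \<longrightarrow> \<alpha> \<le> 1 \<longrightarrow>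
            \<bar>ln (G_bar n (\<alpha> * real n))
              - (f_scale \<alpha> * (real n)\<^sup>2 * ln (real n) + g_scale \<alpha> * (real n)\<^sup>2)\<bar>
            \<le> C * (real n powr (3 / 2) * ln (real n)))
       \<and> (\<exists>C::real. \<forall>n::nat. \<forall>\<alpha>::real. n \<ge> 2 \<longrightarrow> 1 / real n \<le> \<alpha> \<longrightarrow> \<alpha> \<le> 1 / sqrt (real n) \<longrightarrow>
            \<bar>ln (G_bar n (\<alpha> * real n))\<bar> \<le> C * (real n powr (3 / 2) * ln (real n)))"
proof (rule conjI; rule exI; intro allI impI)
  fix n :: nat and \<alpha> :: real
  assume "n \<ge> 2" "1 / sqrt (real n) \<le> \<alpha>" "\<alpha> \<le> 1"
  then show "\<bar>ln (G_bar n (\<alpha> * real n))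
        - (f_scale \<alpha> * (real n)\<^sup>2 * ln (real n) + g_scale \<alpha> * (real n)\<^sup>2)\<bar>
      \<le> 30 * (real n powr (3 / 2) * ln (real n))"
    unfolding powr_three_halves[OF of_nat_0_le_iff] by (rule ln_G_bar_estimate)
next
  fix n :: nat and \<alpha> :: real
  assume n: "n \<ge> 2" and a: "1 / real n \<le> \<alpha>" "\<alpha> \<le> 1 / sqrt (real n)"
  \<comment> \<open>At most \<open>sqrt n\<close> bases occur here, so the uniform bound for each
    base suffices.\<close>
  have "\<alpha> * real n \<le> 1 / sqrt (real n) * real n" using a(2) by (intro mult_right_mono) auto
  also have "\<dots> = sqrt (real n)" using n by (simp add: real_div_sqrt)
  finally have x: "\<alpha> * real n \<le> sqrt (real n)" .
  have "0 \<le> 1 / real n" by simp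
  then have "0 \<le> \<alpha> * real n" using a(1) by (intro mult_nonneg_nonneg) linarith+
  then have "real (nat \<lfloor>\<alpha> * real n\<rfloor>) \<le> \<alpha> * real n" by simp
  then have X: "real (nat \<lfloor>\<alpha> * real n\<rfloor>) \<le> sqrt (real n)" using x by linarith
  moreover have "sqrt (real n) \<le> real n" using n by (intro real_le_lsqrt) (auto simp: power2_eq_square)
  ultimately have "nat \<lfloor>\<alpha> * real n\<rfloor> \<le> n" by linarith
  then show "\<bar>ln (G_bar n (\<alpha> * real n))\<bar> \<le> 6 * (real n powr (3 / 2) * ln (real n))"
    unfolding powr_three_halves[OF of_nat_0_le_iff] ln_G_bar
    using n X by (intro abs_sum_nu_bar_ln_le) auto
qed

end
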